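(* Given $k_0>0$, $n,p,q,r\in\mathbb{Z}_+$ and $\ell\in\mathbb{Z}$, there is a constant $C>0$ (independent of $s$ and $k$) such that, for all $(s,k)\in[0,2P]\times[k_0,\infty)$, $$|D_s^n a_{p,q,r,\ell}(s,k)|\le C\,k^{-\frac{1+2p+3q+r+\ell}{3}+(\ell+1)_-}\times\begin{cases}\displaystyle\sum_{0\le j\le n}W(s,k)^{-j}, & 1+\ell-2r-p<0,\\ \lambda_{p,r,\ell,n}(s,k), & 1+\ell-2r-p\ge 0,\end{cases}$$ where $$\lambda_{p,r,\ell,n}(s,k)=k^{\frac{1+\ell-2r-p}{3}}+\sum_{1+\ell-2r-p<j\le n}W(s,k)^{-j}.$$
   Context: $\mathbb{Z}_+=\{0,1,2,\ldots\}$, $t_-=\min\{t,0\}$, and an empty sum is zero. Let $P>0$ and $0<t_1<t_2<2P$ with $t_1+t_2=2P$ (these are the arc length parameters of the two shadow boundary points of a smooth compact strictly convex planar obstacle of perimeter $2P$). For $k>0$ set $$W(s,k)=k^{-\frac13}+|\omega(s)|,\qquad \omega(s)=(s-t_1)(t_2-s),\qquad s\in[0,2P].$$ For $p,q,r\in\mathbb{Z}_+$, $\ell\in\mathbb{Z}$, $$a_{p,q,r,\ell}(s,k)=k^{-\frac{1+2p+3q+r+\ell}{3}+(\ell+1)_-}\,b_{p,q,r,\ell}(s)\,(\Psi^{r,\ell})^{(p)}(k^{\frac13}Z(s)),$$ the terms of the asymptotic expansion of the slow envelope of the total field in sound-hard scattering. Here: $b_{p,q,r,\ell}$ are $2P$-periodic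 complex-valued $C^\infty$ functions; $Z$ is a $2P$-periodic real-valued $C^\infty$ function that is positive on the illuminated region $(t_1,t_2)$, negative on the shadow region $[0,t_1)\cup(t_2,2P]$, and vanishes precisely to first order at $t_1$ and $t_2$; $\Psi^{r,\ell}:\mathbb{R}\to\mathbb{C}$ are $C^\infty$ functions with asymptotic expansions $\Psi^{r,\ell}(\tau)\sim\sum_{j\in\mathbb{Z}_+}a_{r,\ell,j}\tau^{1+\ell-2r-3j}$ as $\tau\to+\infty$ (in the sense of symbols, i.e. the expansion may be differentiated term by term) and which, with all derivatives, decrease rapidly as $\tau\to-\infty$. *)

theory Defs
  imports "HOL-Analysis.Analysis" "HOL-Library.Landau_Symbols" "HOL-Library.Periodic_Fun"
begin

definition nth_vderiv :: "nat \<Rightarrow> (real \<Rightarrow> 'a::real_normed_vector) \<Rightarrow> real \<Rightarrow> 'a" where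
  "nth_vderiv n f = ((\<lambda>g x. vector_derivative g (at x)) ^^ n) f"

definition smooth_fun :: "(real \<Rightarrow> 'a::real_normed_vector) \<Rightarrow> bool" where
  "smooth_fun f \<longleftrightarrow> (\<forall>n x. nth_vderiv n f differentiable (at x))"

text \<open>\<open>f(\<tau>) \<sim> \<Sum>j. c j * \<tau>\<^sup>\<mu>\<^sup>-\<^sup>3\<^sup>j\<close> as \<open>\<tau> \<rightarrow> +\<infinity>\<close> in the sense of symbols: each
  derivative of each remainder has the size expected from differentiating the first omitted term.
  The values of the powers at \<open>\<tau> \<le> 0\<close> play no role, since the derivatives are local and
  only large \<open>\<tau>\<close> are considered.\<close>

definition symbol_expansion_at_top ::
    "(real \<Rightarrow> complex) \<Rightarrow> (nat \<Rightarrow> complex) \<Rightarrow> int \<Rightarrow> bool" where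
  "symbol_expansion_at_top f c \<mu> \<longleftrightarrow>
     (\<forall>N m. nth_vderiv m (\<lambda>\<tau>. f \<tau> - (\<Sum>j<N. c j * complex_of_real (\<tau> powi (\<mu> - 3 * int j))))
              \<in> O[at_top](\<lambda>\<tau>. complex_of_real (\<tau> powi (\<mu> - 3 * int N - int m))))"

definition rapidly_decreasing_at_bot :: "(real \<Rightarrow> complex) \<Rightarrow> bool" where
  "rapidly_decreasing_at_bot f \<longleftrightarrow>
     (\<forall>m N. nth_vderiv m f \<in> O[at_bot](\<lambda>\<tau>. complex_of_real (\<tau> powi (- int N))))"

definition omega :: "real \<Rightarrow> real \<Rightarrow> real \<Rightarrow> real" where
  "omega t1 t2 s = (s - t1) * (t2 - s)"

definition W :: "real \<Rightarrow> real \<Rightarrow> real \<Rightarrow> real \<Rightarrow> real" where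
  "W t1 t2 s k = k powr (-1/3) + \<bar>omega t1 t2 s\<bar>"

definition minus_part :: "int \<Rightarrow> int" where
  "minus_part t = min t 0"

definition k_exponent :: "nat \<Rightarrow> nat \<Rightarrow> nat \<Rightarrow> int \<Rightarrow> real" where
  "k_exponent p q r l =
     - (1 + 2 * real p + 3 * real q + real r + real_of_int l) / 3
     + real_of_int (minus_part (l + 1))"

definition a_term ::
    "(nat \<Rightarrow> nat \<Rightarrow> nat \<Rightarrow> int \<Rightarrow> real \<Rightarrow> complex) \<Rightarrow> (nat \<Rightarrow> int \<Rightarrow> real \<Rightarrow> complex) \<Rightarrow> (real \<Rightarrow> real) \<Rightarrow>
     nat \<Rightarrow> nat \<Rightarrow> nat \<Rightarrow> int \<Rightarrow> real \<Rightarrow> real \<Rightarrow> complex" where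
  "a_term b \<Psi> Z p q r l s k =
     complex_of_real (k powr k_exponent p q r l) * b p q r l s *
     nth_vderiv p (\<Psi> r l) (k powr (1/3) * Z s)"

definition order_index :: "nat \<Rightarrow> nat \<Rightarrow> int \<Rightarrow> int" where
  "order_index p r l = 1 + l - 2 * int r - int p"

definition lambda_bound ::
    "real \<Rightarrow> real \<Rightarrow> nat \<Rightarrow> nat \<Rightarrow> int \<Rightarrow> nat \<Rightarrow> real \<Rightarrow> real \<Rightarrow> real" where
  "lambda_bound t1 t2 p r l n s k =
     k powr (real_of_int (order_index p r l) / 3) +
     (\<Sum>j \<in> {j::nat. order_index p r l < int j \<and> j \<le> n}. W t1 t2 s k powi (- int j))"

end

theory Submission
  imports Defs
begin

text \<open>
  Write \<open>\<kappa> = k powr (1/3)\<close>, \<open>\<mu> = 1 + l - 2 * r\<close> and \<open>M = \<mu> - p\<close>, which is \<^const>\<open>order_index\<close>. Differentiating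
  \<open>b(s) * g(\<kappa> * Z s)\<close> \<open>n\<close> times, with \<open>g\<close> the \<open>p\<close>-th derivative of the profile, produces terms
  \<open>B(s) * \<kappa>^i * g\<^sup>(\<^sup>i\<^sup>)(\<kappa> * Z s)\<close> with \<open>i \<le> n\<close>, whose coefficients \<open>B\<close> are smooth and do not depend on \<open>k\<close>
  (\<open>nth_vderiv_scaled_composition\<close>). On the compact interval they are bounded, so only the size of
  \<open>\<kappa>^i * g\<^sup>(\<^sup>i\<^sup>)(\<kappa> * Z s)\<close> matters, and it is governed by whether \<open>i\<close> exceeds \<open>M\<close>.

  For \<open>i \<le> M\<close> the leading term of the expansion survives, \<open>g\<^sup>(\<^sup>i\<^sup>)\<close> grows at most like \<open>\<bar>\<tau>\<bar>^(M - i)\<close>, and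
  since \<open>Z\<close> is bounded the product is at most a constant times \<open>\<kappa>^M\<close>, the first term of
  \<^const>\<open>lambda_bound\<close>. For \<open>i > M\<close> the estimate \<open>\<bar>\<tau>\<bar>^(M - i)\<close> would still contain the large factor \<open>\<kappa>^M\<close>.
  The gain comes from the shape of the expansion: those of its terms that do not decay are
  polynomials of degree at most \<open>\<mu>\<close>, which \<open>p + i > \<mu>\<close> derivatives annihilate, so that
  \<open>g\<^sup>(\<^sup>i\<^sup>)(\<tau>) = O((1 + \<bar>\<tau>\<bar>)^(-i))\<close> (\<open>symbol_derivative_bound\<close>). As \<open>Z\<close> has simple zeros exactly where
  \<^const>\<open>omega\<close> vanishes, \<open>\<bar>omega\<bar> \<le> D * \<bar>Z\<bar>\<close> (\<open>quotient_bounded_of_simple_zeros\<close>), hence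
  \<open>\<kappa>^i * (1 + \<kappa> * \<bar>Z\<bar>)^(-i) = (1 / \<kappa> + \<bar>Z\<bar>)^(-i)\<close> is at most a constant times \<open>W^(-i)\<close>. When \<open>M < 0\<close> every \<open>i\<close>
  is of the second kind, which is why both cases of the theorem follow from one argument.
\<close>

section \<open>Smooth functions and iterated derivatives\<close>

lemma nth_vderiv_0 [simp]: "nth_vderiv 0 f = f"
  by (simp add: nth_vderiv_def)

lemma nth_vderiv_Suc: "nth_vderiv (Suc n) f = (\<lambda>x. vector_derivative (nth_vderiv n f) (at x))"
  by (simp add: nth_vderiv_def)

lemma nth_vderiv_Suc_inner:
  "nth_vderiv (Suc n) f = nth_vderiv n (\<lambda>x. vector_derivative f (at x))"
  by (simp add: nth_vderiv_def funpow_Suc_right del: funpow.simps)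

lemma nth_vderiv_add_index: "nth_vderiv (m + n) f = nth_vderiv m (nth_vderiv n f)"
  by (simp add: nth_vderiv_def funpow_add)

lemma smooth_fun_has_vector_derivative:
  "smooth_fun f \<Longrightarrow> (nth_vderiv n f has_vector_derivative nth_vderiv (Suc n) f x) (at x)"
  unfolding smooth_fun_def nth_vderiv_Suc using vector_derivative_works by blast

lemma smooth_fun_continuous_on: "smooth_fun f \<Longrightarrow> continuous_on S (nth_vderiv n f)"
  unfolding smooth_fun_def
  by (meson continuous_at_imp_continuous_on differentiable_imp_continuous_within)

lemma smooth_fun_nth_vderiv: "smooth_fun f \<Longrightarrow> smooth_fun (nth_vderiv n f)"
  unfolding smooth_fun_def by (metis nth_vderiv_add_index)

text \<open>Reduces the computation of all iterated derivatives to guessing them and checking a single step.\<close>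

lemma nth_vderiv_eqI:
  assumes "F 0 = f" "\<And>i x. (F i has_vector_derivative F (Suc i) x) (at x)"
  shows "nth_vderiv n f = F n"
proof (induction n)
  case (Suc n)
  then show ?case
    using assms(2) by (auto simp: nth_vderiv_Suc intro!: vector_derivative_at)
qed (use assms in simp)

text \<open>Finite order of differentiability, with the derivative peeled off from the inside: in contrast
  to \<^const>\<open>nth_vderiv\<close>, this recursion lets the Leibniz rule go through by induction on the order,
  without binomial coefficients.\<close>

primrec times_differentiable :: "nat \<Rightarrow> (real \<Rightarrow> 'a::real_normed_vector) \<Rightarrow> bool" where
  "times_differentiable 0 f \<longleftrightarrow> True"
| "times_differentiable (Suc n) f \<longleftrightarrow>
     (\<forall>x. f differentiable (at x)) \<and> times_differentiable n (\<lambda>x. vector_derivative f (at x))"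

lemma times_differentiable_iff:
  "times_differentiable n f \<longleftrightarrow> (\<forall>m<n. \<forall>x. nth_vderiv m f differentiable (at x))"
proof (induction n arbitrary: f)
  case (Suc n)
  show ?case
    by (simp add: Suc.IH nth_vderiv_Suc_inner All_less_Suc2)
qed simp

lemma smooth_fun_iff_times_differentiable: "smooth_fun f \<longleftrightarrow> (\<forall>n. times_differentiable n f)"
  unfolding smooth_fun_def times_differentiable_iff by blast

lemma times_differentiable_Suc_D: "times_differentiable (Suc n) f \<Longrightarrow> times_differentiable n f"
  unfolding times_differentiable_iff by simp

lemma times_differentiable_add:
  "times_differentiable n f \<Longrightarrow> times_differentiable n g \<Longrightarrow>
   times_differentiable n (\<lambda>x. f x + g x)"
proof (induction n arbitrary: f g)
  case (Suc n)
  have "(\<lambda>x. vector_derivative (\<lambda>x. f x + g x) (at x)) =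
        (\<lambda>x. vector_derivative f (at x) + vector_derivative g (at x))"
    using Suc.prems by (auto simp: fun_eq_iff)
  then show ?case
    using Suc by auto
qed simp

lemma times_differentiable_scaleR:
  fixes f :: "real \<Rightarrow> real"
  shows "times_differentiable n f \<Longrightarrow> times_differentiable n g \<Longrightarrow>
   times_differentiable n (\<lambda>x. f x *\<^sub>R g x)"
proof (induction n arbitrary: f g)
  case (Suc n)
  have deriv: "((\<lambda>x. f x *\<^sub>R g x) has_vector_derivative
      f x *\<^sub>R vector_derivative g (at x) + vector_derivative f (at x) *\<^sub>R g x) (at x)" for x
    using Suc.prems
    by (intro has_vector_derivative_scaleR)
       (auto simp: vector_derivative_works has_real_derivative_iff_has_vector_derivative)
  have "times_differentiable n
      (\<lambda>x. f x *\<^sub>R vector_derivative g (at x) + vector_derivative f (at x) *\<^sub>R g x)"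
    using Suc.prems times_differentiable_Suc_D[OF Suc.prems(1)] times_differentiable_Suc_D[OF Suc.prems(2)]
    by (intro times_differentiable_add Suc.IH) simp_all
  moreover have "(\<lambda>x. vector_derivative (\<lambda>x. f x *\<^sub>R g x) (at x)) =
        (\<lambda>x. f x *\<^sub>R vector_derivative g (at x) + vector_derivative f (at x) *\<^sub>R g x)"
    using deriv by (auto intro: vector_derivative_at)
  ultimately show ?case
    using deriv by (auto intro: differentiableI_vector)
qed simp

lemma smooth_fun_add: "smooth_fun f \<Longrightarrow> smooth_fun g \<Longrightarrow> smooth_fun (\<lambda>x. f x + g x)"
  by (simp add: smooth_fun_iff_times_differentiable times_differentiable_add)

lemma smooth_fun_scaleR: "smooth_fun f \<Longrightarrow> smooth_fun g \<Longrightarrow> smooth_fun (\<lambda>x. f x *\<^sub>R g x)"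
  by (simp add: smooth_fun_iff_times_differentiable times_differentiable_scaleR)

lemma smooth_fun_vector_derivative:
  "smooth_fun f \<Longrightarrow> smooth_fun (\<lambda>x. vector_derivative f (at x))"
  using smooth_fun_nth_vderiv[of f 1] by (simp add: nth_vderiv_Suc)

lemma nth_vderiv_zero: "nth_vderiv n (\<lambda>_. 0) = (\<lambda>_. 0)"
  by (rule nth_vderiv_eqI) auto

lemma smooth_fun_zero: "smooth_fun (\<lambda>_. 0)"
  by (simp add: smooth_fun_def nth_vderiv_zero)

section \<open>Derivatives of a scaled composition\<close>

text \<open>The coefficients of Faa di Bruno's formula for \<open>b * (g \<circ> Z)\<close>, given only by the recursion that
  one further differentiation produces. They involve \<open>b\<close> and \<open>Z\<close> but neither \<open>g\<close> nor the scaling of \<open>Z\<close>,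
  which is what makes the estimates uniform in \<open>k\<close>.\<close>

primrec chain_coeff :: "(real \<Rightarrow> complex) \<Rightarrow> (real \<Rightarrow> real) \<Rightarrow> nat \<Rightarrow> nat \<Rightarrow> real \<Rightarrow> complex" where
  "chain_coeff b Z 0 i = (\<lambda>s. if i = 0 then b s else 0)"
| "chain_coeff b Z (Suc n) i = (\<lambda>s. vector_derivative (chain_coeff b Z n i) (at s) +
     (case i of 0 \<Rightarrow> 0 | Suc j \<Rightarrow> vector_derivative Z (at s) *\<^sub>R chain_coeff b Z n j s))"

lemma chain_coeff_eq_0: "n < i \<Longrightarrow> chain_coeff b Z n i = (\<lambda>_. 0)"
  by (induction n arbitrary: i) (auto split: nat.split)

lemma smooth_fun_chain_coeff:
  assumes "smooth_fun b" "smooth_fun Z"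
  shows "smooth_fun (chain_coeff b Z n i)"
proof (induction n arbitrary: i)
  case 0
  show ?case using assms(1) smooth_fun_zero by (cases "i = 0") auto
next
  case (Suc n)
  show ?case
    by (cases i) (auto intro!: smooth_fun_add smooth_fun_scaleR smooth_fun_vector_derivative
        smooth_fun_zero Suc assms)
qed

text \<open>Each derivative that falls on the outer function contributes one factor \<open>\<kappa>\<close> and one order of
  differentiation of \<open>g\<close>, so the two always occur with the same exponent \<open>i\<close>.\<close>

lemma nth_vderiv_scaled_composition:
  fixes g b :: "real \<Rightarrow> complex" and A :: complex and \<kappa> :: real
  assumes "smooth_fun b" "smooth_fun Z" "smooth_fun g"
  shows "nth_vderiv n (\<lambda>s. A * b s * g (\<kappa> * Z s)) =
    (\<lambda>s. A * (\<Sum>i\<le>n. chain_coeff b Z n i s * (\<kappa> ^ i *\<^sub>R nth_vderiv i g (\<kappa> * Z s))))"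
proof (rule nth_vderiv_eqI)
  fix n s
  define X where "X i s = \<kappa> ^ i *\<^sub>R nth_vderiv i g (\<kappa> * Z s)" for i s
  define Z' where "Z' = vector_derivative Z (at s)"
  let ?B = "chain_coeff b Z"
  let ?D = "\<lambda>i. vector_derivative (?B n i) (at s)"
  have dZ: "((\<lambda>s. \<kappa> * Z s) has_vector_derivative \<kappa> * Z') (at s)"
    using smooth_fun_has_vector_derivative[OF assms(2), of 0]
    by (auto simp: nth_vderiv_Suc Z'_def intro!: derivative_eq_intros)
  have dX: "(X i has_vector_derivative Z' *\<^sub>R X (Suc i) s) (at s)" for i
    using bounded_linear.has_vector_derivative[OF bounded_linear_scaleR_right,
        OF vector_diff_chain_at[OF dZ smooth_fun_has_vector_derivative[OF assms(3), of i]], of "\<kappa> ^ i"]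
    by (simp add: X_def[abs_def] o_def mult_ac)
  have dB: "(?B n i has_vector_derivative ?D i) (at s)" for i
    using smooth_fun_has_vector_derivative[OF smooth_fun_chain_coeff[OF assms(1,2)], of 0 n i]
    by (simp add: nth_vderiv_Suc)
  have "((\<lambda>s. A * (\<Sum>i\<le>n. ?B n i s * X i s)) has_vector_derivative
      A * (\<Sum>i\<le>n. ?B n i s * (Z' *\<^sub>R X (Suc i) s) + ?D i * X i s)) (at s)"
    by (intro has_vector_derivative_mult_right has_vector_derivative_sum
        has_vector_derivative_mult dB dX)
  also have "(\<Sum>i\<le>n. ?B n i s * (Z' *\<^sub>R X (Suc i) s) + ?D i * X i s) =
      (\<Sum>i\<le>Suc n. ?D i * X i s) + (\<Sum>i\<le>n. (Z' *\<^sub>R ?B n i s) * X (Suc i) s)"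
    by (simp add: sum.distrib chain_coeff_eq_0)
  (* Shifting the index of the second sum matches the recursion for the coefficients. *)
  also have "\<dots> = (\<Sum>i\<le>Suc n. ?B (Suc n) i s * X i s)"
    by (simp add: sum.atMost_Suc_shift sum.distrib Z'_def distrib_right del: sum.atMost_Suc)
  finally show "((\<lambda>s. A * (\<Sum>i\<le>n. ?B n i s * (\<kappa> ^ i *\<^sub>R nth_vderiv i g (\<kappa> * Z s)))) has_vector_derivative
      A * (\<Sum>i\<le>Suc n. ?B (Suc n) i s * (\<kappa> ^ i *\<^sub>R nth_vderiv i g (\<kappa> * Z s)))) (at s)"
    by (simp add: X_def)
qed (simp add: fun_eq_iff mult.assoc)

section \<open>Bounds for derivatives of a symbol\<close>

text \<open>The non-decaying part of a symbol expansion is a polynomial and disappears after sufficiently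
  many derivatives. The monomials are indexed by an arbitrary degree function because an expansion
  only uses every third exponent.\<close>

lemma nth_vderiv_minus_polynomial:
  fixes f :: "real \<Rightarrow> complex" and c :: "nat \<Rightarrow> complex" and d :: "nat \<Rightarrow> nat"
  assumes "smooth_fun f" "\<And>j. j < N \<Longrightarrow> d j < m"
  shows "nth_vderiv m (\<lambda>\<tau>. f \<tau> - (\<Sum>j<N. c j * complex_of_real (\<tau> ^ d j))) = nth_vderiv m f"
proof -
  define F where "F i \<tau> = nth_vderiv i f \<tau> -
    (\<Sum>j<N. c j * complex_of_real ((\<Prod>t<i. real (d j - t)) * \<tau> ^ (d j - i)))" for i \<tau>
  (* For i > d j the truncated difference makes the product vanish and the exponent 0. *)
  have dF: "(F i has_vector_derivative F (Suc i) \<tau>) (at \<tau>)" for i \<tau>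
  proof -
    have *: "((\<lambda>\<tau>. (\<Prod>t<i. real (d j - t)) * \<tau> ^ (d j - i)) has_real_derivative
        (\<Prod>t<Suc i. real (d j - t)) * \<tau> ^ (d j - Suc i)) (at \<tau>)" for j
      by (auto intro!: derivative_eq_intros)
    then show ?thesis
      unfolding F_def
      by (intro has_vector_derivative_diff smooth_fun_has_vector_derivative assms(1)
          has_vector_derivative_sum has_vector_derivative_mult_right has_vector_derivative_of_real *)
  qed
  have "nth_vderiv m (\<lambda>\<tau>. f \<tau> - (\<Sum>j<N. c j * complex_of_real (\<tau> ^ d j))) = F m"
    by (rule nth_vderiv_eqI[where F = F]) (simp add: F_def fun_eq_iff, rule dF)
  moreover have "(\<Prod>t<m. real (d j - t)) = 0" if "j < N" for j
    using assms(2)[OF that] by (auto simp: prod_zero_iff)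
  ultimately show ?thesis
    by (auto simp: F_def fun_eq_iff)
qed

lemma bound_from_bigo_at_both_ends:
  fixes f :: "real \<Rightarrow> complex" and g :: "real \<Rightarrow> real"
  assumes cont: "continuous_on UNIV f" "continuous_on UNIV g"
    and pos: "\<And>x. g x > 0"
    and top: "f \<in> O[at_top](\<lambda>x. complex_of_real (g x))"
    and bot: "f \<in> O[at_bot](\<lambda>x. complex_of_real (g x))"
  obtains C where "C > 0" "\<And>x. norm (f x) \<le> C * g x"
proof -
  obtain C1 where C1: "C1 > 0" "eventually (\<lambda>x. norm (f x) \<le> C1 * g x) at_top"
    using landau_o.bigE[OF top] pos by (auto simp: less_imp_le)
  obtain C2 where C2: "C2 > 0" "eventually (\<lambda>x. norm (f x) \<le> C2 * g x) at_bot"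
    using landau_o.bigE[OF bot] pos by (auto simp: less_imp_le)
  obtain u v where u: "\<And>x. x \<ge> u \<Longrightarrow> norm (f x) \<le> C1 * g x"
    and v: "\<And>x. x \<le> v \<Longrightarrow> norm (f x) \<le> C2 * g x"
    using C1(2) C2(2) unfolding eventually_at_top_linorder eventually_at_bot_linorder by blast
  have "compact ((\<lambda>x. norm (f x) / g x) ` {v..u})"
    using pos by (intro compact_continuous_image continuous_intros
        continuous_on_subset[OF cont(1)] continuous_on_subset[OF cont(2)]) (auto simp: less_imp_neq[symmetric])
  from compact_imp_bounded[OF this]
  obtain C3 where "\<forall>x\<in>{v..u}. \<bar>norm (f x) / g x\<bar> \<le> C3"
    unfolding bounded_real by blast
  then have C3: "norm (f x) / g x \<le> C3" if "x \<in> {v..u}" for x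
    using that by (meson abs_le_D1)
  show thesis
  proof (rule that[of "C1 + C2 + \<bar>C3\<bar>"])
    fix x
    consider "x \<ge> u" | "x \<le> v" | "x \<in> {v..u}"
      by fastforce
    then have "norm (f x) / g x \<le> C1 \<or> norm (f x) / g x \<le> C2 \<or> norm (f x) / g x \<le> C3"
      using u[of x] v[of x] C3[of x] pos[of x] by cases (auto simp: pos_divide_le_eq)
    then have "norm (f x) / g x \<le> C1 + C2 + \<bar>C3\<bar>"
      using C1(1) C2(1) by auto
    then show "norm (f x) \<le> (C1 + C2 + \<bar>C3\<bar>) * g x"
      using pos[of x] by (simp add: pos_divide_le_eq)
  qed (use C1 C2 in auto)
qed


text \<open>Replaces the powers \<open>\<tau>^e\<close>, singular at the origin when \<open>e < 0\<close>, by weights that are continuous and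
  positive on the whole line, as needed to pass from asymptotic to global bounds.\<close>

lemma power_int_bigo_japanese:
  fixes F :: "real filter" and e h :: int
  assumes "eventually (\<lambda>\<tau>. \<bar>\<tau>\<bar> \<ge> 1) F" "e \<le> h"
  shows "(\<lambda>\<tau>. complex_of_real (\<tau> powi e)) \<in> O[F](\<lambda>\<tau>. complex_of_real ((1 + \<bar>\<tau>\<bar>) powi h))"
proof (rule bigoI[where c = "2 ^ nat \<bar>h\<bar>"], rule eventually_mono[OF assms(1)])
  fix \<tau> :: real
  assume \<tau>: "\<bar>\<tau>\<bar> \<ge> 1"
  have "\<bar>\<tau>\<bar> powi e \<le> \<bar>\<tau>\<bar> powi h"
    using \<tau> assms(2) by (rule power_int_increasing[rotated])
  also have "\<dots> \<le> 2 ^ nat \<bar>h\<bar> * (1 + \<bar>\<tau>\<bar>) powi h"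
  proof (cases "h \<ge> 0")
    case True
    have "\<bar>\<tau>\<bar> ^ nat h \<le> (1 + \<bar>\<tau>\<bar>) ^ nat h"
      by (intro power_mono) auto
    also have "\<dots> \<le> 2 ^ nat h * (1 + \<bar>\<tau>\<bar>) ^ nat h"
      by simp
    finally show ?thesis
      using True by (simp add: power_int_def)
  next
    case False
    have "(1 + \<bar>\<tau>\<bar>) ^ nat (- h) \<le> (2 * \<bar>\<tau>\<bar>) ^ nat (- h)"
      using \<tau> by (intro power_mono) auto
    moreover have "\<bar>\<tau>\<bar> ^ nat (- h) > 0" "(1 + \<bar>\<tau>\<bar>) ^ nat (- h) > 0"
      using \<tau> by auto
    ultimately show ?thesis
      using False by (simp add: power_int_def power_mult_distrib divide_simps)
  qed
  finally show "norm (complex_of_real (\<tau> powi e)) \<le>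
      2 ^ nat \<bar>h\<bar> * norm (complex_of_real ((1 + \<bar>\<tau>\<bar>) powi h))"
    unfolding norm_of_real power_int_abs by simp
qed

text \<open>For \<open>m > \<mu>\<close> the exponent is \<open>-m\<close> and not merely \<open>\<mu> - m\<close>: the expansion is cut just behind its last
  term of nonnegative exponent. The \<open>m\<close>-th derivative does not see the terms before the cut, and the
  remainder behind it has negative order.\<close>

lemma symbol_derivative_bound:
  fixes f :: "real \<Rightarrow> complex" and \<mu> :: int
  assumes smooth: "smooth_fun f"
    and expansion: "symbol_expansion_at_top f c \<mu>"
    and decay: "rapidly_decreasing_at_bot f"
  obtains C where "C > 0"
    "\<And>\<tau>. norm (nth_vderiv m f \<tau>) \<le>
      C * (1 + \<bar>\<tau>\<bar>) powi (if int m \<le> \<mu> then \<mu> - int m else - int m)"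
proof -
  let ?h = "if int m \<le> \<mu> then \<mu> - int m else - int m"
  (* nat (\<mu> div 3 + 1) is the number of terms with exponent \<mu> - 3 j \<ge> 0; it is 0 for \<mu> < 0. *)
  define N where "N = (if int m \<le> \<mu> then 0 else nat (\<mu> div 3 + 1))"
  have rem: "nth_vderiv m (\<lambda>\<tau>. f \<tau> - (\<Sum>j<N. c j * complex_of_real (\<tau> powi (\<mu> - 3 * int j))))
      = nth_vderiv m f"
  proof -
    have deg: "\<mu> - 3 * int j = int (nat (\<mu> - 3 * int j))" "nat (\<mu> - 3 * int j) < m" if "j < N" for j
      using that by (auto simp: N_def split: if_splits)
    have "(\<lambda>\<tau>. f \<tau> - (\<Sum>j<N. c j * complex_of_real (\<tau> powi (\<mu> - 3 * int j)))) =
        (\<lambda>\<tau>. f \<tau> - (\<Sum>j<N. c j * complex_of_real (\<tau> ^ nat (\<mu> - 3 * int j))))"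
      using deg(1) by (intro ext arg_cong2[where f = minus] refl sum.cong)
        (metis lessThan_iff power_int_of_nat)
    then show ?thesis
      using nth_vderiv_minus_polynomial[OF smooth, of N "\<lambda>j. nat (\<mu> - 3 * int j)" m] deg(2) by simp
  qed
  have "nth_vderiv m f \<in> O[at_top](\<lambda>\<tau>. complex_of_real (\<tau> powi (\<mu> - 3 * int N - int m)))"
    using expansion[unfolded symbol_expansion_at_top_def, rule_format, of m N] by (simp only: rem)
  moreover have "\<mu> - 3 * int N - int m \<le> ?h"
    by (auto simp: N_def)
  moreover have "eventually (\<lambda>\<tau>::real. \<bar>\<tau>\<bar> \<ge> 1) at_top"
    by (rule eventually_mono[OF eventually_ge_at_top[of 1]]) auto
  ultimately have top: "nth_vderiv m f \<in> O[at_top](\<lambda>\<tau>. complex_of_real ((1 + \<bar>\<tau>\<bar>) powi ?h))"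
    using power_int_bigo_japanese landau_o.big_trans by blast
  have "nth_vderiv m f \<in> O[at_bot](\<lambda>\<tau>. complex_of_real (\<tau> powi (- int m)))"
    using decay by (simp only: rapidly_decreasing_at_bot_def)
  moreover have "- int m \<le> ?h"
    by auto
  moreover have "eventually (\<lambda>\<tau>::real. \<bar>\<tau>\<bar> \<ge> 1) at_bot"
    by (rule eventually_mono[OF eventually_le_at_bot[of "-1"]]) auto
  ultimately have bot: "nth_vderiv m f \<in> O[at_bot](\<lambda>\<tau>. complex_of_real ((1 + \<bar>\<tau>\<bar>) powi ?h))"
    using power_int_bigo_japanese landau_o.big_trans by blast
  have "continuous_on UNIV (\<lambda>\<tau>::real. (1 + \<bar>\<tau>\<bar>) powi ?h)"
    by (intro continuous_intros) (auto simp: add_nonneg_eq_0_iff)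
  then show thesis
    using bound_from_bigo_at_both_ends[OF smooth_fun_continuous_on[OF smooth] _ _ top bot] that
    by (metis abs_ge_zero add_pos_nonneg zero_less_one zero_less_power_int)
qed

section \<open>Estimates uniform in the frequency\<close>

text \<open>The quotient \<open>f / g\<close> extends continuously over the zeros of \<open>g\<close> by the quotient of the derivatives,
  and a continuous function on a compact set is bounded.\<close>

lemma quotient_bounded_of_simple_zeros:
  fixes f g f' g' :: "real \<Rightarrow> real"
  assumes "compact K"
    and df: "\<And>x. (f has_real_derivative f' x) (at x)"
    and dg: "\<And>x. (g has_real_derivative g' x) (at x)"
    and zeros: "\<And>x. x \<in> K \<Longrightarrow> g x = 0 \<Longrightarrow> f x = 0 \<and> g' x \<noteq> 0"
  obtains C where "\<And>x. x \<in> K \<Longrightarrow> \<bar>f x\<bar> \<le> C * \<bar>g x\<bar>"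
proof -
  define h where "h x = (if g x = 0 then f' x / g' x else f x / g x)" for x
  have "isCont h x" if "x \<in> K" for x
  proof (cases "g x = 0")
    case True
    let ?u = "\<lambda>y. (f y - f x) / (y - x)" and ?v = "\<lambda>y. (g y - g x) / (y - x)"
    have z: "f x = 0" "g' x \<noteq> 0"
      using zeros[OF that True] by auto
    have lim: "?u \<midarrow>x\<rightarrow> f' x" "?v \<midarrow>x\<rightarrow> g' x"
      using df dg by (auto simp: has_field_derivative_iff)
    have "(\<lambda>y. ?u y / ?v y) \<midarrow>x\<rightarrow> f' x / g' x"
      using lim z by (intro tendsto_divide) auto
    moreover have "\<forall>\<^sub>F y in at x. ?u y / ?v y = h y"
      using tendsto_imp_eventually_ne[OF lim(2) z(2)] eventually_neq_at_within[of x x UNIV]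
      by eventually_elim (auto simp: h_def z True)
    ultimately have "h \<midarrow>x\<rightarrow> f' x / g' x"
      by (rule Lim_transform_eventually)
    then show ?thesis
      by (simp add: isCont_def h_def True)
  next
    case False
    have "\<forall>\<^sub>F y in nhds x. g y \<noteq> 0"
      using DERIV_isCont[OF dg] False
      by (intro tendsto_imp_eventually_ne) (auto simp: isCont_def tendsto_at_iff_tendsto_nhds)
    then have "\<forall>\<^sub>F y in nhds x. h y = f y / g y"
      by eventually_elim (simp add: h_def)
    then have "isCont h x \<longleftrightarrow> isCont (\<lambda>y. f y / g y) x"
      by (rule isCont_cong)
    then show ?thesis
      using DERIV_isCont[OF df] DERIV_isCont[OF dg] False by auto
  qed
  then have "compact (h ` K)"
    using \<open>compact K\<close> by (intro compact_continuous_image continuous_at_imp_continuous_on) auto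
  from compact_imp_bounded[OF this] obtain C where C: "\<forall>x\<in>K. \<bar>h x\<bar> \<le> C"
    unfolding bounded_real by blast
  show thesis
  proof (rule that[of C])
    fix x
    assume "x \<in> K"
    then show "\<bar>f x\<bar> \<le> C * \<bar>g x\<bar>"
      using C zeros[of x] by (cases "g x = 0") (force simp: h_def abs_divide pos_divide_le_eq)+
  qed
qed


text \<open>With \<open>z\<close> bounded and \<open>\<kappa>\<close> bounded away from \<open>0\<close>, the weight \<open>1 + \<bar>\<kappa> * z\<bar>\<close> is at most a multiple of \<open>\<kappa>\<close>.\<close>

lemma scaled_growth_bound:
  fixes \<kappa> \<kappa>0 z M G C :: real
  assumes "0 < \<kappa>0" "\<kappa>0 \<le> \<kappa>" "\<bar>z\<bar> \<le> M" "0 \<le> C" "G \<le> C * (1 + \<bar>\<kappa> * z\<bar>) ^ d"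
  shows "\<kappa> ^ i * G \<le> C * (1 / \<kappa>0 + M) ^ d * \<kappa> ^ (i + d)"
proof -
  have "1 + \<bar>\<kappa> * z\<bar> \<le> \<kappa> / \<kappa>0 + \<kappa> * M"
    using assms(1-3) by (intro add_mono) (auto simp: abs_mult intro!: mult_left_mono)
  also have "\<dots> = \<kappa> * (1 / \<kappa>0 + M)"
    by (simp add: algebra_simps)
  finally have "(1 + \<bar>\<kappa> * z\<bar>) ^ d \<le> (\<kappa> * (1 / \<kappa>0 + M)) ^ d"
    by (intro power_mono) auto
  then have "G \<le> C * (\<kappa> * (1 / \<kappa>0 + M)) ^ d"
    using assms(4,5) by (meson mult_left_mono order_trans)
  then have "\<kappa> ^ i * G \<le> \<kappa> ^ i * (C * (\<kappa> * (1 / \<kappa>0 + M)) ^ d)"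
    using assms(1,2) by (intro mult_left_mono) auto
  then show ?thesis
    by (simp add: power_mult_distrib power_add mult_ac)
qed

text \<open>The factors \<open>\<kappa>\<close> are absorbed exactly, because \<open>1 + \<kappa> * \<bar>z\<bar> = \<kappa> * (1 / \<kappa> + \<bar>z\<bar>)\<close>.\<close>

lemma scaled_decay_bound:
  fixes \<kappa> z w D G C :: real
  assumes "0 < \<kappa>" "1 \<le> D" "\<bar>w\<bar> \<le> D * \<bar>z\<bar>" "0 \<le> C" "G \<le> C * (1 + \<bar>\<kappa> * z\<bar>) powi (- int i)"
  shows "\<kappa> ^ i * G \<le> C * D ^ i * (1 / \<kappa> + \<bar>w\<bar>) powi (- int i)"
proof -
  have pos: "0 < 1 + \<bar>\<kappa> * z\<bar>" "0 < 1 / \<kappa> + \<bar>w\<bar>"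
    using assms(1) by (auto intro: add_pos_nonneg)
  have "\<kappa> * (1 / \<kappa> + \<bar>w\<bar>) = 1 + \<kappa> * \<bar>w\<bar>"
    using assms(1) by (simp add: field_simps)
  also have "\<dots> \<le> D + \<kappa> * (D * \<bar>z\<bar>)"
    using assms(1-3) by (intro add_mono mult_left_mono) auto
  also have "\<dots> = D * (1 + \<bar>\<kappa> * z\<bar>)"
    using assms(1) by (simp add: abs_mult algebra_simps)
  finally have "\<kappa> / (1 + \<bar>\<kappa> * z\<bar>) \<le> D / (1 / \<kappa> + \<bar>w\<bar>)"
    by (simp only: pos_divide_le_eq[OF pos(1)] times_divide_eq_left pos_le_divide_eq[OF pos(2)])
  then have *: "(\<kappa> / (1 + \<bar>\<kappa> * z\<bar>)) ^ i \<le> (D / (1 / \<kappa> + \<bar>w\<bar>)) ^ i"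
    using pos(1) assms(1) by (intro power_mono) auto
  have "\<kappa> ^ i * G \<le> \<kappa> ^ i * (C * (1 + \<bar>\<kappa> * z\<bar>) powi (- int i))"
    using assms(1,5) by (intro mult_left_mono) auto
  also have "\<dots> = C * (\<kappa> / (1 + \<bar>\<kappa> * z\<bar>)) ^ i"
    by (simp add: power_int_minus divide_inverse power_mult_distrib power_inverse)
  also have "\<dots> \<le> C * (D / (1 / \<kappa> + \<bar>w\<bar>)) ^ i"
    using * assms(4) by (rule mult_left_mono)
  also have "\<dots> = C * D ^ i * (1 / \<kappa> + \<bar>w\<bar>) powi (- int i)"
    by (simp add: power_int_minus divide_inverse power_mult_distrib power_inverse)
  finally show ?thesis .
qed

definition derivative_bound :: "real \<Rightarrow> real \<Rightarrow> nat \<Rightarrow> nat \<Rightarrow> int \<Rightarrow> nat \<Rightarrow> real \<Rightarrow> real \<Rightarrow> real" where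
  "derivative_bound t1 t2 p r l n s k =
     (if order_index p r l < 0 then (\<Sum>j\<le>n. W t1 t2 s k powi (- int j))
      else lambda_bound t1 t2 p r l n s k)"

lemma W_pos: "k > 0 \<Longrightarrow> W t1 t2 s k > 0"
  by (simp add: W_def add_pos_nonneg)

lemma W_cube_root: "W t1 t2 s k = 1 / k powr (1 / 3) + \<bar>omega t1 t2 s\<bar>"
  by (simp add: W_def powr_minus_divide)

lemma derivative_bound_nonneg: "k > 0 \<Longrightarrow> 0 \<le> derivative_bound t1 t2 p r l n s k"
  unfolding derivative_bound_def lambda_bound_def
  by (auto intro!: sum_nonneg add_nonneg_nonneg zero_le_power_int less_imp_le[OF W_pos])

lemma W_power_le_derivative_bound:
  assumes "k > 0" "i \<le> n" "order_index p r l < int i"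
  shows "W t1 t2 s k powi (- int i) \<le> derivative_bound t1 t2 p r l n s k"
proof (cases "order_index p r l < 0")
  case True
  then show ?thesis
    using assms W_pos[OF assms(1)]
    by (auto simp: derivative_bound_def less_imp_le intro!: member_le_sum[of i "{..n}"])
next
  case False
  have "W t1 t2 s k powi (- int i) \<le>
      (\<Sum>j\<in>{j. order_index p r l < int j \<and> j \<le> n}. W t1 t2 s k powi (- int j))"
    using assms W_pos[OF assms(1)] by (intro member_le_sum) (auto simp: less_imp_le)
  then show ?thesis
    using False by (simp add: derivative_bound_def lambda_bound_def add_increasing)
qed

lemma cube_root_power_le_derivative_bound:
  assumes "k > 0" "0 \<le> order_index p r l"
  shows "(k powr (1 / 3)) ^ nat (order_index p r l) \<le> derivative_bound t1 t2 p r l n s k"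
proof -
  have "(k powr (1 / 3)) ^ nat (order_index p r l) = k powr (real_of_int (order_index p r l) / 3)"
    using assms by (simp add: powr_realpow[symmetric] powr_powr)
  moreover have "0 \<le> (\<Sum>j\<in>{j. order_index p r l < int j \<and> j \<le> n}. W t1 t2 s k powi (- int j))"
    using W_pos[OF assms(1)] by (intro sum_nonneg) (simp add: less_imp_le)
  ultimately show ?thesis
    using assms(2) by (simp add: derivative_bound_def lambda_bound_def)
qed

text \<open>The dichotomy between growth (\<open>i \<le> M\<close>) and decay (\<open>i > M\<close>) of a single term of the expanded
  derivative.\<close>

lemma scaled_profile_bound:
  fixes f :: "real \<Rightarrow> complex" and Z :: "real \<Rightarrow> real"
  assumes f: "smooth_fun f" "symbol_expansion_at_top f c (1 + l - 2 * int r)"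
      "rapidly_decreasing_at_bot f"
    and Z: "\<And>s. s \<in> S \<Longrightarrow> \<bar>Z s\<bar> \<le> M" "\<And>s. s \<in> S \<Longrightarrow> \<bar>omega t1 t2 s\<bar> \<le> D * \<bar>Z s\<bar>"
    and "1 \<le> D" "0 < k0" "i \<le> n"
  obtains C where "0 \<le> C"
    "\<And>s k. s \<in> S \<Longrightarrow> k0 \<le> k \<Longrightarrow>
      (k powr (1 / 3)) ^ i * norm (nth_vderiv (i + p) f (k powr (1 / 3) * Z s))
      \<le> C * derivative_bound t1 t2 p r l n s k"
proof -
  let ?\<mu> = "1 + l - 2 * int r" and ?M = "order_index p r l"
  let ?h = "if int (i + p) \<le> ?\<mu> then ?\<mu> - int (i + p) else - int (i + p)"
  obtain C where C: "C > 0"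
    "\<And>\<tau>. norm (nth_vderiv (i + p) f \<tau>) \<le> C * (1 + \<bar>\<tau>\<bar>) powi ?h"
    using symbol_derivative_bound[OF f] by blast
  show thesis
  proof (cases "int i \<le> ?M")
    case True
    define d where "d = nat (?M - int i)"
    have h: "?h = int d" "i + d = nat ?M"
      using True by (auto simp: d_def order_index_def)
    show thesis
    proof (rule that[of "C * \<bar>1 / k0 powr (1 / 3) + M\<bar> ^ d"])
      fix s k
      assume sk: "s \<in> S" "k0 \<le> k"
      have M: "0 \<le> 1 / k0 powr (1 / 3) + M"
        using Z(1)[OF sk(1)] by (intro add_nonneg_nonneg) auto
      have "(k powr (1 / 3)) ^ i * norm (nth_vderiv (i + p) f (k powr (1 / 3) * Z s)) \<le>
          C * (1 / k0 powr (1 / 3) + M) ^ d * (k powr (1 / 3)) ^ (i + d)"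
        using C(2)[of "k powr (1 / 3) * Z s"] \<open>0 < k0\<close> sk C(1) Z(1)[OF sk(1)]
        unfolding h(1)
        by (intro scaled_growth_bound) (auto intro: powr_mono2)
      also have "\<dots> \<le> C * (1 / k0 powr (1 / 3) + M) ^ d * derivative_bound t1 t2 p r l n s k"
        unfolding h(2) using \<open>0 < k0\<close> sk C(1) M True
        by (intro mult_left_mono cube_root_power_le_derivative_bound) auto
      finally show "(k powr (1 / 3)) ^ i * norm (nth_vderiv (i + p) f (k powr (1 / 3) * Z s)) \<le>
          C * \<bar>1 / k0 powr (1 / 3) + M\<bar> ^ d * derivative_bound t1 t2 p r l n s k"
        using M by simp
    qed (use C in simp)
  next
    case False
    then have h: "?h \<le> - int i"
      by (simp add: order_index_def)
    show thesis
    proof (rule that[of "C * D ^ i"])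
      fix s k
      assume sk: "s \<in> S" "k0 \<le> k"
      have "(1 + \<bar>k powr (1 / 3) * Z s\<bar>) powi ?h \<le> (1 + \<bar>k powr (1 / 3) * Z s\<bar>) powi (- int i)"
        using h by (rule power_int_increasing) simp
      then have "norm (nth_vderiv (i + p) f (k powr (1 / 3) * Z s)) \<le>
          C * (1 + \<bar>k powr (1 / 3) * Z s\<bar>) powi (- int i)"
        using C(1) C(2)[of "k powr (1 / 3) * Z s"] by (meson less_imp_le mult_left_mono order_trans)
      then have "(k powr (1 / 3)) ^ i * norm (nth_vderiv (i + p) f (k powr (1 / 3) * Z s)) \<le>
          C * D ^ i * W t1 t2 s k powi (- int i)"
        unfolding W_cube_root using \<open>0 < k0\<close> sk C(1) \<open>1 \<le> D\<close> Z(2)[OF sk(1)]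
        by (intro scaled_decay_bound) auto
      also have "\<dots> \<le> C * D ^ i * derivative_bound t1 t2 p r l n s k"
        using \<open>0 < k0\<close> sk C(1) \<open>1 \<le> D\<close> False \<open>i \<le> n\<close>
        by (intro mult_left_mono W_power_le_derivative_bound) auto
      finally show "(k powr (1 / 3)) ^ i * norm (nth_vderiv (i + p) f (k powr (1 / 3) * Z s)) \<le>
          C * D ^ i * derivative_bound t1 t2 p r l n s k" .
    qed (use C \<open>1 \<le> D\<close> in simp)
  qed
qed

lemma smooth_fun_bounded_on_compact:
  assumes "smooth_fun f" "compact K"
  obtains B where "0 \<le> B" "\<And>x. x \<in> K \<Longrightarrow> norm (f x) \<le> B"
proof -
  have "compact (f ` K)"
    using smooth_fun_continuous_on[OF assms(1), of K 0] assms(2) by (simp add: compact_continuous_image)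
  then obtain B where "\<forall>y\<in>f ` K. norm y \<le> B"
    using compact_imp_bounded bounded_iff by blast
  then show thesis
    using that[of "\<bar>B\<bar>"] by fastforce
qed

section \<open>The bound for the terms of the expansion\<close>

theorem lemma5:
  fixes P t1 t2 :: real
    and b :: "nat \<Rightarrow> nat \<Rightarrow> nat \<Rightarrow> int \<Rightarrow> real \<Rightarrow> complex"
    and Z :: "real \<Rightarrow> real"
    and \<Psi> :: "nat \<Rightarrow> int \<Rightarrow> real \<Rightarrow> complex"
    and c :: "nat \<Rightarrow> int \<Rightarrow> nat \<Rightarrow> complex"
    and k0 :: real
    and n p q r :: nat
    and l :: int
  assumes "P > 0" and "0 < t1" and "t1 < t2" and "t2 < 2 * P" and "t1 + t2 = 2 * P"
    and b_smooth: "\<And>p q r l. smooth_fun (b p q r l)"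
    and b_periodic: "\<And>p q r l. periodic_fun_simple (b p q r l) (2 * P)"
    and Z_smooth: "smooth_fun Z"
    and Z_periodic: "periodic_fun_simple Z (2 * P)"
    and Z_pos: "\<And>s. s \<in> {t1<..<t2} \<Longrightarrow> Z s > 0"
    and Z_neg: "\<And>s. s \<in> {0..<t1} \<union> {t2<..2 * P} \<Longrightarrow> Z s < 0"
    and Z_t1: "Z t1 = 0" "deriv Z t1 \<noteq> 0"
    and Z_t2: "Z t2 = 0" "deriv Z t2 \<noteq> 0"
    and \<Psi>_smooth: "\<And>r l. smooth_fun (\<Psi> r l)"
    and \<Psi>_expansion: "\<And>r l. symbol_expansion_at_top (\<Psi> r l) (c r l) (1 + l - 2 * int r)"
    and \<Psi>_decay: "\<And>r l. rapidly_decreasing_at_bot (\<Psi> r l)"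
    and "k0 > 0"
  shows "\<exists>C>0. \<forall>s\<in>{0..2 * P}. \<forall>k\<in>{k0..}.
           norm (nth_vderiv n (\<lambda>s. a_term b \<Psi> Z p q r l s k) s)
           \<le> C * k powr k_exponent p q r l *
             (if order_index p r l < 0 then (\<Sum>j\<le>n. W t1 t2 s k powi (- int j))
              else lambda_bound t1 t2 p r l n s k)"
proof -
  let ?S = "{0..2 * P}" and ?B = "chain_coeff (b p q r l) Z n"
  let ?R = "derivative_bound t1 t2 p r l n"
  have Z_deriv: "(Z has_real_derivative deriv Z x) (at x)" for x
    using smooth_fun_has_vector_derivative[OF Z_smooth, of 0 x] DERIV_imp_deriv
    by (fastforce simp: has_real_derivative_iff_has_vector_derivative[symmetric])
  have omega_deriv: "(omega t1 t2 has_real_derivative (t2 - x) - (x - t1)) (at x)" for x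
    unfolding omega_def[abs_def] by (auto intro!: derivative_eq_intros)
  have Z_zero: "s = t1 \<or> s = t2" if "s \<in> ?S" "Z s = 0" for s
    using Z_pos[of s] Z_neg[of s] that by force
  obtain D0 where D0: "\<And>s. s \<in> ?S \<Longrightarrow> \<bar>omega t1 t2 s\<bar> \<le> D0 * \<bar>Z s\<bar>"
  proof (rule quotient_bounded_of_simple_zeros[OF _ omega_deriv Z_deriv])
    show "compact ?S" by simp
  qed (use Z_zero Z_t1 Z_t2 in \<open>auto simp: omega_def\<close>)
  define D where "D = max 1 D0"
  have D: "\<bar>omega t1 t2 s\<bar> \<le> D * \<bar>Z s\<bar>" if "s \<in> ?S" for s
    using D0[OF that] mult_right_mono[of D0 D "\<bar>Z s\<bar>"] by (simp add: D_def)
  obtain M where M: "\<And>s. s \<in> ?S \<Longrightarrow> \<bar>Z s\<bar> \<le> M"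
    using smooth_fun_bounded_on_compact[OF Z_smooth, of ?S] by auto
  have "\<exists>C\<ge>0. \<forall>s\<in>?S. \<forall>k\<ge>k0.
      (k powr (1 / 3)) ^ i * norm (nth_vderiv (i + p) (\<Psi> r l) (k powr (1 / 3) * Z s)) \<le> C * ?R s k"
    if "i \<le> n" for i
    by (rule scaled_profile_bound[OF \<Psi>_smooth[of r l] \<Psi>_expansion[of r l] \<Psi>_decay[of r l]
          M D _ \<open>k0 > 0\<close> that, where p = p])
       (assumption, assumption, simp add: D_def, blast)
  then obtain C where C: "\<And>i. i \<le> n \<Longrightarrow> 0 \<le> C i"
    "\<And>i s k. i \<le> n \<Longrightarrow> s \<in> ?S \<Longrightarrow> k0 \<le> k \<Longrightarrow>
      (k powr (1 / 3)) ^ i * norm (nth_vderiv (i + p) (\<Psi> r l) (k powr (1 / 3) * Z s)) \<le> C i * ?R s k"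
    by metis
  have "\<exists>E\<ge>0. \<forall>s\<in>?S. norm (?B i s) \<le> E" for i
    using smooth_fun_bounded_on_compact[OF smooth_fun_chain_coeff[OF b_smooth Z_smooth], of ?S]
    by (metis compact_Icc)
  then obtain E where E: "\<And>i. 0 \<le> E i" "\<And>i s. s \<in> ?S \<Longrightarrow> norm (?B i s) \<le> E i"
    by metis
  have "norm (nth_vderiv n (\<lambda>s. a_term b \<Psi> Z p q r l s k) s)
      \<le> (1 + (\<Sum>i\<le>n. E i * C i)) * k powr k_exponent p q r l * ?R s k"
    if sk: "s \<in> ?S" "k0 \<le> k" for s k
  proof -
    let ?\<kappa> = "k powr (1 / 3)" and ?A = "k powr k_exponent p q r l"
    have R: "0 \<le> ?R s k"
      using sk \<open>k0 > 0\<close> by (intro derivative_bound_nonneg) auto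
    have expand: "nth_vderiv n (\<lambda>s. a_term b \<Psi> Z p q r l s k) s =
        complex_of_real ?A *
        (\<Sum>i\<le>n. ?B i s * (?\<kappa> ^ i *\<^sub>R nth_vderiv (i + p) (\<Psi> r l) (?\<kappa> * Z s)))"
      unfolding a_term_def nth_vderiv_add_index
      by (simp only: nth_vderiv_scaled_composition[OF b_smooth Z_smooth
          smooth_fun_nth_vderiv[OF \<Psi>_smooth]])
    have "norm (nth_vderiv n (\<lambda>s. a_term b \<Psi> Z p q r l s k) s) = ?A *
        norm (\<Sum>i\<le>n. ?B i s * (?\<kappa> ^ i *\<^sub>R nth_vderiv (i + p) (\<Psi> r l) (?\<kappa> * Z s)))"
      unfolding expand by (simp add: norm_mult)
    also have "\<dots> \<le> ?A * (\<Sum>i\<le>n. E i * (C i * ?R s k))"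
    proof (rule mult_left_mono[OF sum_norm_le])
      fix i
      assume "i \<in> {..n}"
      then have i: "i \<le> n" by simp
      have "norm (?B i s * (?\<kappa> ^ i *\<^sub>R nth_vderiv (i + p) (\<Psi> r l) (?\<kappa> * Z s))) =
          norm (?B i s) * (?\<kappa> ^ i * norm (nth_vderiv (i + p) (\<Psi> r l) (?\<kappa> * Z s)))"
        by (simp add: norm_mult)
      also have "\<dots> \<le> E i * (C i * ?R s k)"
        by (rule mult_mono[OF E(2)[OF sk(1)] C(2)[OF i sk] E(1)]) simp
      finally show "norm (?B i s * (?\<kappa> ^ i *\<^sub>R nth_vderiv (i + p) (\<Psi> r l) (?\<kappa> * Z s)))
          \<le> E i * (C i * ?R s k)" .
    qed simp
    also have "\<dots> = (\<Sum>i\<le>n. E i * C i) * (?A * ?R s k)"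
      by (simp add: sum_distrib_left sum_distrib_right mult_ac)
    also have "\<dots> \<le> (1 + (\<Sum>i\<le>n. E i * C i)) * (?A * ?R s k)"
      using R by (intro mult_right_mono) auto
    finally show ?thesis
      by (simp add: mult.assoc)
  qed
  moreover have "0 < 1 + (\<Sum>i\<le>n. E i * C i)"
    using C(1) E(1) by (intro add_pos_nonneg sum_nonneg) auto
  ultimately show ?thesis
    unfolding derivative_bound_def by fastforce
qed

end
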